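(* Let $a,b$ be positive integers. Every regular configuration $\Delta\in\mathrm{CONF}(a,b)$ is symmetric, i.e. $|\mathrm{Rot}(\Delta)|=\gcd(a,b)$.
   Context: $\mathrm{CONF}(a,b)$ is the set of necklaces (circular arrangements up to rotation) of $a$ red and $b$ black beads; let $n=a+b$. For $\Delta$ with black beads $B_0,\dots,B_{b-1}$ in cyclic order, its characteristic sequence $\{x_0,\dots,x_{b-1}\}$ lists the number $x_i$ of red beads between $B_i$ and $B_{i+1}$ (indices mod $b$); it is defined up to cyclic shift and has sum $a$. $\Delta$ is regular if $\frac{a}{b}k-1 < x_i+\dots+x_{i+k-1} < \frac{a}{b}k+1$ for all $0\le i\le b-1$ and $1\le k\le 1+\lfloor b/2\rfloor$ (indices mod $b$). A labelled necklace is obtained by labelling the beads of $\Delta$ consecutively $0,\dots,n-1$ around the circle; let $t_i$ be the bead labelled $i$. A rotation $\phi_k(i)=i+k \bmod n$, with $k\in[0,n-1]$, is a cyclic permutation of $\Delta$ if $t_i$ and $t_{\phi_k(i)}$ have the same color for every $i$. These rotations form the symmetry group $\mathrm{Rot}(\Delta)$, whose size does not depend on the chosen labelling. $\Delta$ is symmetric if $|\mathrm{Rot}(\Delta)|=\gcd(a,b)$. *)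

theory Defs
  imports Complex_Main
begin

datatype color = Red | Black

text \<open>
  A labelled necklace with \<open>n\<close> beads is a word \<open>w\<close> of length \<open>n\<close>; the bead \<open>t\<^sub>i\<close> is \<open>w ! i\<close>.
  A necklace is a class of such words up to rotation, so the words representing it are exactly
  its labelled versions.
\<close>

definition rot_equiv :: "color list \<Rightarrow> color list \<Rightarrow> bool" where
  "rot_equiv v w \<longleftrightarrow> (\<exists>m. w = rotate m v)"

lemma rot_equiv_sym: "rot_equiv v w \<Longrightarrow> rot_equiv w v"
proof -
  assume "rot_equiv v w"
  then obtain m where w: "w = rotate m v" unfolding rot_equiv_def by blast
  show ?thesis
  proof (cases "v = []")
    case True
    then show ?thesis using w by (simp add: rot_equiv_def)
  next
    case False
    then have "m mod length v + (length v - m mod length v) = length v"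
      by (simp add: less_imp_le)
    then have "(length v - m mod length v + m) mod length v = 0"
      by (metis add.commute mod_add_left_eq mod_self)
    then have "rotate (length v - m mod length v) w = v"
      unfolding w rotate_rotate by (rule rotate_id)
    then show ?thesis unfolding rot_equiv_def by metis
  qed
qed

lemma equivp_rot_equiv: "equivp rot_equiv"
proof (rule equivpI)
  show "reflp rot_equiv"
    by (rule reflpI) (metis rot_equiv_def rotate0 id_apply)
  show "symp rot_equiv"
    by (rule sympI) (rule rot_equiv_sym)
  show "transp rot_equiv"
    by (rule transpI) (metis rot_equiv_def rotate_rotate)
qed

quotient_type necklace = "color list" / rot_equiv
  by (rule equivp_rot_equiv)

lemma rot_equiv_invariant:
  assumes "\<And>w. P w \<Longrightarrow> P (rotate1 w)" and "rot_equiv v w"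
  shows "P v \<longleftrightarrow> P w"
proof -
  have step: "P (rotate m u)" if "P u" for m u
    using that assms(1) by (induction m) auto
  show ?thesis
    using step assms(2) rot_equiv_sym[OF assms(2)] unfolding rot_equiv_def by metis
qed

lift_definition num_red :: "necklace \<Rightarrow> nat" is "\<lambda>w. count_list w Red"
proof -
  fix v w assume "rot_equiv v w"
  moreover have "count_list (rotate1 u) Red = count_list u Red" for u
    by (cases u) auto
  ultimately show "count_list v Red = count_list w Red"
    using rot_equiv_invariant[of "\<lambda>u. count_list u Red = count_list v Red" v w] by simp
qed

lift_definition num_black :: "necklace \<Rightarrow> nat" is "\<lambda>w. count_list w Black"
proof -
  fix v w assume "rot_equiv v w"
  moreover have "count_list (rotate1 u) Black = count_list u Black" for u
    by (cases u) auto
  ultimately show "count_list v Black = count_list w Black"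
    using rot_equiv_invariant[of "\<lambda>u. count_list u Black = count_list v Black" v w] by simp
qed

definition CONF :: "nat \<Rightarrow> nat \<Rightarrow> necklace set" where
  "CONF a b = {\<Delta>. num_red \<Delta> = a \<and> num_black \<Delta> = b}"

text \<open>The labels of the black beads \<open>B\<^sub>0, \<dots>, B\<^bsub>b-1\<^esub>\<close>, in increasing order.\<close>

definition black_labels :: "color list \<Rightarrow> nat list" where
  "black_labels w = filter (\<lambda>i. w ! i = Black) [0..<length w]"

text \<open>
  Going around the circle from label \<open>p\<close> (exclusive) in the direction of increasing labels to
  the next visit of label \<open>q\<close> (exclusive), one passes \<open>j\<close>. If \<open>p = q\<close>, which happens when
  there is only one black bead, this is the whole circle without \<open>p\<close>.
\<close>

definition cyc_between :: "nat \<Rightarrow> nat \<Rightarrow> nat \<Rightarrow> bool" where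
  "cyc_between p q j \<longleftrightarrow> (if p < q then p < j \<and> j < q else p < j \<or> j < q)"

definition reds_between :: "color list \<Rightarrow> nat \<Rightarrow> nat \<Rightarrow> nat" where
  "reds_between w p q = card {j. j < length w \<and> w ! j = Red \<and> cyc_between p q j}"

definition char_seq :: "color list \<Rightarrow> nat list" where
  "char_seq w = (let B = black_labels w; b = length B in
     map (\<lambda>i. reds_between w (B ! i) (B ! ((i + 1) mod b))) [0..<b])"

definition regular_word :: "color list \<Rightarrow> bool" where
  "regular_word w \<longleftrightarrow>
     (let a = count_list w Red; b = count_list w Black; x = char_seq w in
      \<forall>i<b. \<forall>k\<in>{1..1 + b div 2}.
        real a / real b * real k - 1 < real (\<Sum>j<k. x ! ((i + j) mod b)) \<and>
        real (\<Sum>j<k. x ! ((i + j) mod b)) < real a / real b * real k + 1)"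

lemma length_black_labels: "length (black_labels w) = count_list w Black"
proof (induction w rule: rev_induct)
  case (snoc c w)
  have "filter (\<lambda>i. (w @ [c]) ! i = Black) [0..<length w] = black_labels w"
    unfolding black_labels_def by (rule filter_cong) (auto simp: nth_append)
  then show ?case using snoc by (simp add: black_labels_def)
qed (simp add: black_labels_def)

lemma length_char_seq: "length (char_seq w) = count_list w Black"
  by (simp add: char_seq_def Let_def length_black_labels)

lemma black_labels_Cons:
  "black_labels (c # w) = (if c = Black then [0] else []) @ map Suc (black_labels w)"
proof -
  have "[0..<length (c # w)] = 0 # map Suc [0..<length w]"
    by (simp add: map_Suc_upt upt_conv_Cons del: upt_Suc)
  then show ?thesis by (simp add: black_labels_def filter_map o_def del: upt_Suc)
qed

lemma black_labels_snoc:
  "black_labels (w @ [c]) = black_labels w @ (if c = Black then [length w] else [])"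
proof -
  have "filter (\<lambda>i. (w @ [c]) ! i = Black) [0..<length w] = black_labels w"
    unfolding black_labels_def by (rule filter_cong) (auto simp: nth_append)
  then show ?thesis by (simp add: black_labels_def)
qed

lemma cyc_between_shift:
  assumes "p < n" "q < n" "j < n"
  shows "cyc_between (Suc p mod n) (Suc q mod n) (Suc j mod n) \<longleftrightarrow> cyc_between p q j"
  using assms unfolding cyc_between_def
  by (cases "Suc p = n"; cases "Suc q = n"; cases "Suc j = n") auto

lemma reds_between_rotate1:
  assumes "p < length w" "q < length w"
  shows "reds_between (rotate1 w) p q
       = reds_between w (Suc p mod length w) (Suc q mod length w)"
proof -
  let ?n = "length w"
  have n: "x mod ?n < ?n" for x
    using assms(1) by (intro mod_less_divisor) linarith
  have "bij_betw (\<lambda>j. Suc j mod ?n)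
     {j. j < length (rotate1 w) \<and> rotate1 w ! j = Red \<and> cyc_between p q j}
     {j. j < ?n \<and> w ! j = Red \<and> cyc_between (Suc p mod ?n) (Suc q mod ?n) j}"
  proof (rule bij_betw_imageI)
    have "inj_on (\<lambda>j. Suc j mod ?n) {..<?n}"
      by (rule inj_onI) (auto simp: mod_Suc split: if_splits)
    then show "inj_on (\<lambda>j. Suc j mod ?n)
        {j. j < length (rotate1 w) \<and> rotate1 w ! j = Red \<and> cyc_between p q j}"
      by (rule inj_on_subset) auto
    have "j \<in> (\<lambda>j. Suc j mod ?n) `
        {j. j < length (rotate1 w) \<and> rotate1 w ! j = Red \<and> cyc_between p q j}"
      if j: "j < ?n" "w ! j = Red" "cyc_between (Suc p mod ?n) (Suc q mod ?n) j" for j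
    proof -
      define i where "i = (if j = 0 then ?n - 1 else j - 1)"
      have i: "i < ?n" "Suc i mod ?n = j" using j(1) by (auto simp: i_def)
      then have "cyc_between p q i" "rotate1 w ! i = Red"
        using cyc_between_shift[OF assms i(1)] j by (auto simp: nth_rotate1)
      then show ?thesis using i by (intro image_eqI[of _ _ i]) auto
    qed
    then show "(\<lambda>j. Suc j mod ?n) `
        {j. j < length (rotate1 w) \<and> rotate1 w ! j = Red \<and> cyc_between p q j}
      = {j. j < ?n \<and> w ! j = Red \<and> cyc_between (Suc p mod ?n) (Suc q mod ?n) j}"
      using cyc_between_shift[OF assms] n by (auto simp: nth_rotate1)
  qed
  then show ?thesis unfolding reds_between_def by (rule bij_betw_same_card)
qed

lemma black_labels_rotate1:
  "map (\<lambda>p. Suc p mod length w) (black_labels (rotate1 w))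
     = (if w \<noteq> [] \<and> hd w = Black then rotate1 (black_labels w) else black_labels w)"
proof (cases w)
  case (Cons c u)
  have "\<forall>p\<in>set (black_labels u). p < length u" by (auto simp: black_labels_def)
  then have "map (\<lambda>p. Suc p mod Suc (length u)) (black_labels u) = map Suc (black_labels u)"
    by auto
  then show ?thesis by (simp add: Cons black_labels_Cons black_labels_snoc)
qed (simp add: black_labels_def)

lemma char_seq_rotate1:
  "char_seq (rotate1 w) = char_seq w \<or> char_seq (rotate1 w) = rotate1 (char_seq w)"
proof -
  let ?n = "length w" and ?B = "black_labels w" and ?B' = "black_labels (rotate1 w)"
  let ?b = "length ?B"
  let ?C = "map (\<lambda>p. Suc p mod ?n) ?B'"
  have len: "length ?C = ?b" by (simp add: black_labels_rotate1)
  then have len': "length ?B' = ?b" by simp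
  have lt: "?B' ! i < ?n" if "i < ?b" for i
  proof -
    have "?B' ! i \<in> set ?B'" using that len' by (metis nth_mem)
    then show ?thesis by (simp add: black_labels_def)
  qed
  have eq: "char_seq (rotate1 w)
      = map (\<lambda>i. reds_between w (?C ! i) (?C ! ((i + 1) mod ?b))) [0..<?b]"
    unfolding char_seq_def Let_def len'
  proof (rule map_cong[OF refl])
    fix i assume "i \<in> set [0..<?b]"
    then have "i < ?b" by simp
    then have i: "i < ?b" "(i + 1) mod ?b < ?b" by (simp, intro mod_less_divisor) linarith
    show "reds_between (rotate1 w) (?B' ! i) (?B' ! ((i + 1) mod ?b))
        = reds_between w (?C ! i) (?C ! ((i + 1) mod ?b))"
      using reds_between_rotate1[OF lt[OF i(1)] lt[OF i(2)]] i len'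
      by (simp only: nth_map)
  qed
  show ?thesis
  proof (cases "w \<noteq> [] \<and> hd w = Black")
    case True
    then have C: "?C = rotate1 ?B" by (simp add: black_labels_rotate1)
    have "char_seq (rotate1 w) = rotate1 (char_seq w)"
      unfolding eq C
    proof (rule nth_equalityI)
      fix i assume "i < length (map (\<lambda>i. reds_between w (rotate1 ?B ! i)
          (rotate1 ?B ! ((i + 1) mod ?b))) [0..<?b])"
      then have "i < ?b" by simp
      then have i: "i < ?b" "Suc i mod ?b < ?b" by (simp, intro mod_less_divisor) linarith
      then show "map (\<lambda>i. reds_between w (rotate1 ?B ! i)
          (rotate1 ?B ! ((i + 1) mod ?b))) [0..<?b] ! i = rotate1 (char_seq w) ! i"
        by (simp add: nth_rotate1 char_seq_def Let_def)
    qed (simp add: char_seq_def Let_def)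
    then show ?thesis ..
  next
    case False
    then have "?C = ?B" by (auto simp: black_labels_rotate1)
    then show ?thesis unfolding eq by (simp add: char_seq_def Let_def)
  qed
qed

lemma regular_word_rotate1:
  assumes "regular_word w" shows "regular_word (rotate1 w)"
proof -
  have cnt: "count_list (rotate1 w) c = count_list w c" for c by (cases w) auto
  let ?b = "count_list w Black"
  consider "char_seq (rotate1 w) = char_seq w" | "char_seq (rotate1 w) = rotate1 (char_seq w)"
    using char_seq_rotate1 by blast
  then show ?thesis
  proof cases
    case 1
    then show ?thesis using assms by (simp add: regular_word_def cnt)
  next
    case 2
    have "(\<Sum>j<k. rotate1 (char_seq w) ! ((i + j) mod ?b))
        = (\<Sum>j<k. char_seq w ! ((Suc i mod ?b + j) mod ?b))" if "i < ?b" for i k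
    proof (rule sum.cong[OF refl])
      fix j
      have "(i + j) mod ?b < length (char_seq w)" using that by (simp add: length_char_seq)
      then show "rotate1 (char_seq w) ! ((i + j) mod ?b)
          = char_seq w ! ((Suc i mod ?b + j) mod ?b)"
        by (simp add: nth_rotate1 length_char_seq mod_simps)
    qed
    moreover have "Suc i mod ?b < ?b" if "i < ?b" for i
      using that by (intro mod_less_divisor) simp
    ultimately show ?thesis
      using assms by (simp add: regular_word_def cnt 2 Let_def del: of_nat_sum)
  qed
qed

lift_definition regular :: "necklace \<Rightarrow> bool" is regular_word
  using rot_equiv_invariant regular_word_rotate1 by blast

definition rot_map :: "nat \<Rightarrow> nat \<Rightarrow> nat \<Rightarrow> nat" where
  "rot_map n k i = (i + k) mod n"

text \<open>
  The rotations are the maps \<open>rot_map n k\<close> themselves; distinct \<open>k < n\<close> give distinct maps, as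
  their values at \<open>0\<close> differ.
\<close>

definition Rot_word :: "color list \<Rightarrow> (nat \<Rightarrow> nat) set" where
  "Rot_word w = (let n = length w in
     {rot_map n k | k. k < n \<and> (\<forall>i<n. w ! i = w ! rot_map n k i)})"

lemma Rot_word_rotate1: "Rot_word w \<subseteq> Rot_word (rotate1 w)"
proof -
  let ?n = "length w"
  have "rotate1 w ! i = rotate1 w ! rot_map ?n k i"
    if k: "\<forall>i<?n. w ! i = w ! rot_map ?n k i" and i: "i < ?n" for i k
  proof -
    have n: "rot_map ?n k i < ?n" "Suc i mod ?n < ?n" using i unfolding rot_map_def by (intro mod_less_divisor; linarith)+
    have "rot_map ?n k (Suc i mod ?n) = Suc (rot_map ?n k i) mod ?n"
      by (simp add: rot_map_def mod_simps)
    then show ?thesis using k n i by (simp add: nth_rotate1)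
  qed
  then show ?thesis by (auto simp: Rot_word_def Let_def)
qed

lift_definition Rot :: "necklace \<Rightarrow> (nat \<Rightarrow> nat) set" is Rot_word
proof -
  fix v w assume vw: "rot_equiv v w"
  have "f \<in> Rot_word v \<longleftrightarrow> f \<in> Rot_word w" for f
    by (rule rot_equiv_invariant[OF _ vw]) (use Rot_word_rotate1 in blast)
  then show "Rot_word v = Rot_word w" by blast
qed

definition symmetric :: "necklace \<Rightarrow> bool" where
  "symmetric \<Delta> \<longleftrightarrow> card (Rot \<Delta>) = gcd (num_red \<Delta>) (num_black \<Delta>)"

end

theory Submission
  imports Defs
begin

text \<open>
  Read the word of a configuration periodically and put \<open>g = gcd a b\<close>. The rotations preserving
  the colours are the periods of this sequence, that is, the multiples of its least period \<open>p\<close>, so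
  there are \<open>n div p\<close> of them, and \<open>n div p\<close> divides both colour counts, hence \<open>g\<close>. Conversely,
  regularity with \<open>k = b div g\<close> puts an integer strictly between \<open>a div g - 1\<close> and
  \<open>a div g + 1\<close>; hence any \<open>b div g\<close> consecutive gaps between black beads contain exactly
  \<open>a div g\<close> red beads, the black beads are invariant under the shift by \<open>n div g\<close>, and \<open>p\<close>
  divides \<open>n div g\<close>.
\<close>

section \<open>Periods of sequences indexed by the naturals\<close>

definition is_period :: "(nat \<Rightarrow> 'a) \<Rightarrow> nat \<Rightarrow> bool" where
  "is_period f p \<longleftrightarrow> (\<forall>i. f (i + p) = f i)"

lemma is_period_mult:
  assumes "is_period f p"
  shows "f (i + d * p) = f i"
proof (induction d)
  case (Suc d)
  have "f (i + Suc d * p) = f ((i + d * p) + p)"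
    by (simp add: algebra_simps)
  then show ?case
    using assms Suc by (simp add: is_period_def)
qed simp

text \<open>The remainder \<open>q mod p\<close> is again a period and lies below \<open>p\<close>;
  if it were positive, it would contradict minimality.\<close>

lemma least_period_dvd:
  assumes p: "is_period f p" "p > 0"
    and least: "\<And>q. 0 < q \<Longrightarrow> is_period f q \<Longrightarrow> p \<le> q"
    and q: "is_period f q"
  shows "p dvd q"
proof (rule ccontr)
  assume "\<not> p dvd q"
  then have pos: "0 < q mod p"
    by (simp add: dvd_eq_mod_eq_0)
  have "f (i + q mod p) = f i" for i
  proof -
    have "f (i + q mod p) = f ((i + q mod p) + (q div p) * p)"
      by (simp only: is_period_mult[OF p(1)])
    also have "\<dots> = f (i + q)"
      by (simp only: add.assoc mod_div_mult_eq)
    finally show ?thesis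
      using q by (simp add: is_period_def)
  qed
  then have "p \<le> q mod p"
    using least[OF pos] by (simp add: is_period_def)
  with p(2) show False
    by (meson mod_less_divisor not_less)
qed

text \<open>Induction on \<open>d\<close>: the block of indices added at each step is the translate
  by \<open>d * p\<close> of the first block, with the same values of \<open>f\<close>.\<close>

lemma card_eq_period_mult:
  assumes "is_period f p"
  shows "card {i. i < d * p \<and> f i = c} = d * card {i. i < p \<and> f i = c}"
proof (induction d)
  case (Suc d)
  let ?A = "{i. i < d * p \<and> f i = c}" and ?C = "{i. i < p \<and> f i = c}"
  have "{i. i < Suc d * p \<and> f i = c} = ?A \<union> (\<lambda>i. i + d * p) ` ?C"
  proof (intro set_eqI iffI)
    fix i assume i: "i \<in> {i. i < Suc d * p \<and> f i = c}"
    show "i \<in> ?A \<union> (\<lambda>i. i + d * p) ` ?C"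
    proof (cases "i < d * p")
      case False
      then have e: "i = (i - d * p) + d * p" by simp
      then have "f (i - d * p) = c"
        using is_period_mult[OF assms, of "i - d * p" d] i by simp
      moreover have "i - d * p < p" using i False by auto
      ultimately show ?thesis using e by blast
    qed (use i in auto)
  qed (auto simp: is_period_mult[OF assms])
  moreover have "card (?A \<union> (\<lambda>i. i + d * p) ` ?C) = card ?A + card ((\<lambda>i. i + d * p) ` ?C)"
    by (rule card_Un_disjoint) auto
  moreover have "card ((\<lambda>i. i + d * p) ` ?C) = card ?C"
    by (rule card_image) (auto intro: inj_onI)
  ultimately show ?case using Suc by simp
qed simp

lemma card_multiples_less:
  assumes "p > 0"
  shows "card {k. k < d * p \<and> p dvd k} = d"
proof -
  have "{k. k < d * p \<and> p dvd k} = (\<lambda>i. i * p) ` {..<d}"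
    using assms by (auto simp: dvd_def mult.commute)
  moreover have "inj_on (\<lambda>i. i * p) {..<d}"
    using assms by (auto intro: inj_onI)
  ultimately show ?thesis
    by (simp add: card_image)
qed

section \<open>Colour-preserving rotations as periods of the repeated word\<close>

lemma count_list_eq_card: "count_list w c = card {i. i < length w \<and> w ! i = c}"
  by (simp add: count_list_eq_length_filter length_filter_conv_card eq_commute)

text \<open>Every natural number reduces modulo \<open>length w\<close> to a valid index of the
  nonempty word, so the bounded condition in \<open>Rot_word\<close> already controls all
  arguments.\<close>

lemma is_period_word_iff:
  assumes "w \<noteq> []"
  shows "is_period (\<lambda>i. w ! (i mod length w)) k
    \<longleftrightarrow> (\<forall>i<length w. w ! i = w ! rot_map (length w) k i)"
proof
  assume "is_period (\<lambda>i. w ! (i mod length w)) k"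
  then show "\<forall>i<length w. w ! i = w ! rot_map (length w) k i"
    by (auto simp: is_period_def rot_map_def)
next
  assume r: "\<forall>i<length w. w ! i = w ! rot_map (length w) k i"
  have "w ! ((i + k) mod length w) = w ! (i mod length w)" for i
    using r[rule_format, of "i mod length w"] assms by (simp add: rot_map_def mod_simps)
  then show "is_period (\<lambda>i. w ! (i mod length w)) k"
    by (simp add: is_period_def)
qed

lemma card_Rot_word:
  assumes "w \<noteq> []"
  shows "card (Rot_word w) = card {k. k < length w \<and> is_period (\<lambda>i. w ! (i mod length w)) k}"
proof -
  have "Rot_word w = rot_map (length w) `
      {k. k < length w \<and> is_period (\<lambda>i. w ! (i mod length w)) k}"
    unfolding Rot_word_def Let_def is_period_word_iff[OF assms] by blast
  moreover have "inj_on (rot_map (length w)) {..<length w}"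
  proof (rule inj_onI)
    fix k l assume kl: "k \<in> {..<length w}" "l \<in> {..<length w}"
      and eq: "rot_map (length w) k = rot_map (length w) l"
    from eq have "rot_map (length w) k 0 = rot_map (length w) l 0"
      by (rule fun_cong)
    then show "k = l"
      using kl by (simp add: rot_map_def)
  qed
  then have "inj_on (rot_map (length w))
      {k. k < length w \<and> is_period (\<lambda>i. w ! (i mod length w)) k}"
    by (rule inj_on_subset) auto
  ultimately show ?thesis
    by (simp add: card_image)
qed

lemma count_list_color: "count_list w Red + count_list w Black = length w"
proof (induction w)
  case (Cons c w)
  then show ?case by (cases c) auto
qed simp

text \<open>Let \<open>d\<close> be the number of least periods that fit into the word. Each colour
  count is \<open>d\<close> times the count in one least period, so \<open>d dvd g\<close>; the
  assumed period yields \<open>g dvd d\<close>.\<close>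

lemma card_Rot_word_eq_gcd:
  fixes w :: "color list"
  defines "g \<equiv> gcd (count_list w Red) (count_list w Black)"
  assumes "w \<noteq> []" and per: "is_period (\<lambda>i. w ! (i mod length w)) (length w div g)"
  shows "card (Rot_word w) = g"
proof -
  let ?f = "\<lambda>i. w ! (i mod length w)" and ?n = "length w"
  have "?n > 0" using \<open>w \<noteq> []\<close> by simp
  have g: "g dvd ?n"
    unfolding g_def count_list_color[of w, symmetric] by (intro dvd_add) auto
  have n: "is_period ?f ?n" by (simp add: is_period_def)
  \<comment> \<open>Positivity has to be required, since \<open>0\<close> is always a period (the
    identity rotation). The length of the word witnesses existence.\<close>
  define p where "p = (LEAST p. 0 < p \<and> is_period ?f p)"
  have "0 < p \<and> is_period ?f p"
    unfolding p_def by (rule LeastI[of _ ?n]) (use n \<open>?n > 0\<close> in blast)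
  then have p: "0 < p" "is_period ?f p" by blast+
  have dvd: "p dvd q" if "is_period ?f q" for q
    by (rule least_period_dvd[OF p(2,1) _ that]) (unfold p_def, blast intro: Least_le)
  obtain d where d: "?n = d * p"
    using dvd[OF n] by (metis dvd_def mult.commute)
  have "d dvd count_list w c" for c
  proof -
    have "{i. i < ?n \<and> w ! i = c} = {i. i < ?n \<and> ?f i = c}"
      by auto
    then have "count_list w c = card {i. i < d * p \<and> ?f i = c}"
      by (simp only: count_list_eq_card d[symmetric])
    then show ?thesis
      unfolding card_eq_period_mult[OF p(2)] by simp
  qed
  then have "d dvd g" by (simp add: g_def)
  obtain m where m: "?n div g = p * m" using dvd[OF per] by (rule dvdE)
  \<comment> \<open>Two factorizations of the length; cancelling \<open>p\<close> leaves
    \<open>d = g * m\<close>.\<close>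
  have "d * p = g * (?n div g)"
    unfolding d[symmetric] using g by simp
  then have "d * p = (g * m) * p"
    unfolding m by (simp only: mult.assoc mult.commute[of p])
  then have "g dvd d" using p(1) by simp
  with \<open>d dvd g\<close> have "d = g" by (rule dvd_antisym)
  have "is_period ?f k \<longleftrightarrow> p dvd k" for k
  proof
    assume "p dvd k"
    then obtain e where "k = e * p" by (metis dvd_def mult.commute)
    then show "is_period ?f k"
      unfolding is_period_def using is_period_mult[OF p(2)] by blast
  qed (rule dvd)
  then have "{k. k < ?n \<and> is_period ?f k} = {k. k < d * p \<and> p dvd k}"
    unfolding d[symmetric] by blast
  then show ?thesis
    unfolding card_Rot_word[OF \<open>w \<noteq> []\<close>]
    by (simp only: card_multiples_less[OF p(1)] \<open>d = g\<close>)
qed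

section \<open>Positions of the black beads and the shift forced by regularity\<close>

lemma set_black_labels: "set (black_labels w) = {i. i < length w \<and> w ! i = Black}"
  by (auto simp: black_labels_def)

lemma sorted_black_labels: "sorted_wrt (<) (black_labels w)"
  unfolding black_labels_def by (intro sorted_wrt_filter) simp

lemma black_labels_nth_less_iff:
  assumes "i < length (black_labels w)" "j < length (black_labels w)"
  shows "black_labels w ! i < black_labels w ! j \<longleftrightarrow> i < j"
  using assms sorted_wrt_nth_less[OF sorted_black_labels, of i j w]
    sorted_wrt_nth_less[OF sorted_black_labels, of j i w]
  by (metis less_asym linorder_neqE_nat)

text \<open>The position of the \<open>i\<close>-th black bead when the word is repeated indefinitely.\<close>

definition black_pos :: "color list \<Rightarrow> nat \<Rightarrow> nat" where
  "black_pos w i = (let B = black_labels w; b = length B in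
     B ! (i mod b) + length w * (i div b))"

text \<open>All beads strictly between cyclically consecutive black beads are red, so the gap
  counted by \<open>char_seq\<close> is the distance minus one. The wrap from the last black bead to
  the first is treated separately.\<close>

lemma black_pos_Suc:
  assumes "black_labels w \<noteq> []"
  shows "black_pos w (Suc i)
    = black_pos w i + Suc (char_seq w ! (i mod length (black_labels w)))"
proof -
  define B where "B = black_labels w"
  define b where "b = length B"
  define n where "n = length w"
  define r where "r = i mod b"
  have b: "b > 0" using assms by (simp add: b_def B_def)
  then have r: "r < b" by (simp add: r_def)
  have lt: "B ! j < n" if "j < b" for j
    using nth_mem[of j B] that set_black_labels[of w] by (auto simp: B_def b_def n_def)
  have mono: "B ! j < B ! k \<longleftrightarrow> j < k" if "j < b" "k < b" for j k
    using black_labels_nth_less_iff[of j w k] that by (simp add: B_def b_def)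
  have black: "\<exists>k<b. B ! k = j" if "j < n" "w ! j = Black" for j
    using that set_black_labels[of w] by (auto simp: in_set_conv_nth B_def b_def n_def)
  have x: "char_seq w ! r = reds_between w (B ! r) (B ! (Suc r mod b))"
    using r by (simp add: char_seq_def Let_def B_def b_def)
  show ?thesis
  proof (cases "Suc r = b")
    case False
    then have s: "Suc r < b" using r by simp
    \<comment> \<open>A black bead there would have its index strictly between \<open>r\<close> and
      \<open>Suc r\<close>.\<close>
    have "w ! j = Red" if gap: "B ! r < j" "j < B ! Suc r" for j
    proof (cases "w ! j")
      case Black
      then obtain k where "k < b" "B ! k = j"
        using black[of j] gap lt[OF s] by auto
      then have "r < k" "k < Suc r"
        using gap mono[OF r, of k] mono[OF _ s, of k] by auto
      then show ?thesis by simp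
    qed
    then have "{j. j < length w \<and> w ! j = Red \<and> cyc_between (B ! r) (B ! Suc r) j}
        = {B ! r<..<B ! Suc r}"
      using mono[OF r s] lt[OF s] by (auto simp: cyc_between_def n_def)
    then have "char_seq w ! r = B ! Suc r - Suc (B ! r)"
      using x s by (simp add: reds_between_def)
    moreover have "Suc i mod b = Suc r" "Suc i div b = i div b"
      using False by (auto simp: mod_Suc div_Suc r_def)
    ultimately show ?thesis
      using mono[OF r s]
      by (simp add: black_pos_def Let_def B_def[symmetric] b_def[symmetric] r_def[symmetric])
  next
    case True
    \<comment> \<open>Equality occurs for a single black bead, whose gap is the rest of the circle.
      In general the gap is the end of one copy of the word followed by the start of the
      next.\<close>
    have "B ! 0 \<le> B ! r" using mono[OF r b] by auto
    have "w ! j = Red" if gap: "j < n" "B ! r < j \<or> j < B ! 0" for j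
    proof (cases "w ! j")
      case Black
      then obtain k where "k < b" "B ! k = j"
        using black[of j] gap by auto
      then show ?thesis
        using gap mono[OF r, of k] mono[OF _ b, of k] True by auto
    qed
    then have "{j. j < length w \<and> w ! j = Red \<and> cyc_between (B ! r) (B ! 0) j}
        = {B ! r<..<n} \<union> {..<B ! 0}"
      using \<open>B ! 0 \<le> B ! r\<close> lt[OF b] by (auto simp: cyc_between_def n_def)
    moreover have "card ({B ! r<..<n} \<union> {..<B ! 0}) = card {B ! r<..<n} + card {..<B ! 0}"
      using \<open>B ! 0 \<le> B ! r\<close> by (intro card_Un_disjoint) auto
    ultimately have "char_seq w ! r = n - Suc (B ! r) + B ! 0"
      using x True by (simp add: reds_between_def)
    \<comment> \<open>Starting a new turn adds \<open>length w\<close> in \<open>black_pos\<close>,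
      which accounts for the wrap.\<close>
    moreover have "Suc i mod b = 0" "Suc i div b = Suc (i div b)"
      using True by (auto simp: mod_Suc div_Suc r_def)
    ultimately show ?thesis
      using lt[OF r]
      by (simp add: black_pos_def Let_def B_def[symmetric] b_def[symmetric] r_def[symmetric]
          n_def[symmetric])
  qed
qed

lemma black_pos_add:
  assumes "black_labels w \<noteq> []"
  shows "black_pos w (i + k)
    = black_pos w i + k + (\<Sum>j<k. char_seq w ! ((i + j) mod length (black_labels w)))"
  by (induction k) (simp_all add: black_pos_Suc[OF assms])

text \<open>The black bead \<open>b div gcd a b\<close> places further along the cyclic list of
  black beads lies exactly \<open>length w div gcd a b\<close> labels ahead, because the reds passed
  on the way number \<open>a div gcd a b\<close>.\<close>

lemma regular_word_shift_black:
  fixes w :: "color list"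
  defines "a \<equiv> count_list w Red" and "b \<equiv> count_list w Black"
  assumes reg: "regular_word w" and b: "b > 0" and g: "gcd a b > 1"
    and j: "w ! (j mod length w) = Black"
  shows "w ! ((j + length w div gcd a b) mod length w) = Black"
proof -
  define g where "g = gcd a b"
  define B where "B = black_labels w"
  define n where "n = length w"
  have B: "length B = b" "B \<noteq> []"
    using b length_black_labels[of w] by (auto simp: B_def b_def)
  obtain a' b' where a': "a = g * a'" and b': "b = g * b'"
    unfolding g_def by (meson dvd_def gcd_dvd1 gcd_dvd2)
  have "n = a + b"
    using count_list_color[of w] by (simp add: n_def a_def b_def)
  then have n: "n = g * (a' + b')" by (simp add: a' b' algebra_simps)
  have "g > 1" using g by (simp add: g_def)
  then have q: "n div g = a' + b'" by (simp add: n)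
  have "b' > 0" using b b' by (cases b') auto
  \<comment> \<open>From \<open>g > 1\<close> the window length \<open>b'\<close> is at most
    \<open>b div 2\<close>, hence in the range covered by regularity.\<close>
  have "2 * b' \<le> b" using \<open>g > 1\<close> by (simp add: b')
  then have k: "b' \<in> {1..1 + b div 2}" using \<open>b' > 0\<close> by auto
  have "n > 0" using n \<open>g > 1\<close> \<open>b' > 0\<close> by simp
  then have "j mod n \<in> set B"
    using j by (simp add: B_def set_black_labels n_def)
  then obtain i where i: "i < b" "B ! i = j mod n"
    using B by (auto simp: in_set_conv_nth)
  \<comment> \<open>The window length \<open>b'\<close> makes the mean number of reds the integer
    \<open>a'\<close>, so the strict bounds of regularity leave only one value.\<close>
  have ab: "real a / real b * real b' = real a'"
    using \<open>b' > 0\<close> \<open>g > 1\<close> by (simp add: a' b')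
  let ?s = "\<Sum>j<b'. char_seq w ! ((i + j) mod b)"
  have "real a' - 1 < real ?s" "real ?s < real a' + 1"
    using reg[unfolded regular_word_def Let_def, folded a_def b_def, rule_format, OF i(1) k]
    unfolding ab by blast+
  then have "?s = a'" by linarith
  then have "black_pos w (i + b') = black_pos w i + (a' + b')"
    using black_pos_add[of w i b'] B by (simp add: B_def)
  then have "B ! ((i + b') mod b) + n * ((i + b') div b) = j mod n + (a' + b')"
    using i B by (simp add: black_pos_def Let_def B_def[symmetric] n_def[symmetric])
  \<comment> \<open>Reducing modulo \<open>n\<close> discards the completed turns.\<close>
  then have e: "B ! ((i + b') mod b) mod n = (j + (a' + b')) mod n"
    by (metis mod_add_left_eq mod_mult_self2)
  have "B ! ((i + b') mod b) \<in> set B" using B b by simp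
  then show ?thesis
    using e q by (simp add: B_def set_black_labels n_def g_def)
qed

text \<open>With only two colours it suffices that the shift both preserves and reflects
  blackness.\<close>

lemma regular_word_period:
  fixes w :: "color list"
  defines "g \<equiv> gcd (count_list w Red) (count_list w Black)"
  assumes reg: "regular_word w" and b: "count_list w Black > 0"
  shows "is_period (\<lambda>i. w ! (i mod length w)) (length w div g)"
proof (cases "g > 1")
  case True
  let ?n = "length w"
  define q where "q = ?n div g"
  have "g dvd ?n"
    unfolding g_def count_list_color[of w, symmetric] by (intro dvd_add) auto
  then have n: "g * q = ?n" by (simp add: q_def)
  have step: "w ! ((j + q) mod ?n) = Black" if "w ! (j mod ?n) = Black" for j
    using regular_word_shift_black[OF reg b _ that] True by (simp add: g_def q_def)
  have steps: "w ! ((j + d * q) mod ?n) = Black" if "w ! (j mod ?n) = Black" for j d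
  proof (induction d)
    case (Suc d)
    then show ?case using step[of "j + d * q"] by (simp add: algebra_simps)
  qed (use that in simp)
  have iff: "w ! ((j + q) mod ?n) = Black \<longleftrightarrow> w ! (j mod ?n) = Black" for j
  proof
    \<comment> \<open>Shifting \<open>g - 1\<close> more times goes once around the circle, back to \<open>j\<close>.\<close>
    assume "w ! ((j + q) mod ?n) = Black"
    from steps[OF this, of "g - 1"] have "w ! ((j + q + (g - 1) * q) mod ?n) = Black" .
    moreover have "j + q + (g - 1) * q = j + ?n"
      using True n by (cases g) auto
    ultimately show "w ! (j mod ?n) = Black" by (simp only: mod_add_self2)
  qed (rule step)
  have "w ! ((j + q) mod ?n) = w ! (j mod ?n)" for j
    using iff[of j] by (cases "w ! ((j + q) mod ?n)"; cases "w ! (j mod ?n)") simp_all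
  then show ?thesis by (simp add: is_period_def q_def)
next
  \<comment> \<open>For coprime counts the claimed period is the full length of the word.\<close>
  case False
  moreover have "g > 0" using b by (simp add: g_def)
  ultimately have "g = 1" by simp
  then show ?thesis by (simp add: is_period_def)
qed

theorem theorem4:
  fixes a b :: nat and \<Delta> :: necklace
  assumes "a > 0" and "b > 0"
    and "\<Delta> \<in> CONF a b"
    and "regular \<Delta>"
  shows "symmetric \<Delta>"
proof -
  have "num_black \<Delta> > 0"
    using assms by (simp add: CONF_def)
  then have "card (Rot \<Delta>) = gcd (num_red \<Delta>) (num_black \<Delta>)"
    using \<open>regular \<Delta>\<close>
  proof transfer
    fix w assume b: "0 < count_list w Black" and reg: "regular_word w"
    then have "w \<noteq> []" by auto
    then show "card (Rot_word w) = gcd (count_list w Red) (count_list w Black)"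
      by (rule card_Rot_word_eq_gcd) (rule regular_word_period[OF reg b])
  qed
  then show ?thesis by (simp add: symmetric_def)
qed

end
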